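(* Let $n\ge1$. The map $w\mapsto(V(w),n-\tau_V(w))$ is a bijection between the set of simple walks of length $n$ and the set of Vervaat pairs $(v,k)$ with $v$ having length $n$.
   Context: Intervals $[a,b]$ denote intervals of integers. A simple walk of length $n$ is a function $w:[0,n]\to\mathbb Z$ with $w(0)=0$ and $x_i:=w(i)-w(i-1)\in\{+1,-1\}$ for $i\in[1,n]$. For such $w$, $\tau_V(w)=\min\{j\in[0,n]: w(j)\le w(i)\text{ for all }i\in[0,n]\}$; $\psi_w$ is the cyclic permutation $i\mapsto i+\tau_V(w)\bmod n$ of $[1,n]$, with representatives modulo $n$ taken in $[1,n]$; the Vervaat transform is the walk $V(w)(j)=\sum_{i=1}^jx_{\psi_w(i)}$, $j\in[0,n]$. A Vervaat pair is a pair $(v,k)$ with $v$ a simple walk of length $n$ and $k$ an integer, $0\le k\le n$, such that $v(j)\ge0$ for $0\le j\le k$ and $v(j)>v(n)$ for $k\le j<n$. *)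

theory Defs
  imports Main "HOL-Library.FuncSet"
begin

text \<open>A function on the integer interval \<open>[0,n]\<close> is an element of \<open>extensional {0..n}\<close>, so that
  equality of walks is equality on \<open>[0,n]\<close>.\<close>

definition step :: "(nat \<Rightarrow> int) \<Rightarrow> nat \<Rightarrow> int" where
  "step w i = w i - w (i - 1)"

definition simple_walks :: "nat \<Rightarrow> (nat \<Rightarrow> int) set" where
  "simple_walks n =
    {w \<in> extensional {0..n}. w 0 = 0 \<and> (\<forall>i\<in>{1..n}. step w i \<in> {1, -1})}"

definition tau_V :: "nat \<Rightarrow> (nat \<Rightarrow> int) \<Rightarrow> nat" where
  "tau_V n w = Min {j \<in> {0..n}. \<forall>i\<in>{0..n}. w j \<le> w i}"

definition cyc_rep :: "nat \<Rightarrow> nat \<Rightarrow> nat" where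
  \<comment> \<open>the representative of \<open>m\<close> modulo \<open>n\<close> in \<open>[1,n]\<close>, rather than in \<open>[0,n-1]\<close>\<close>
  "cyc_rep n m = (if m mod n = 0 then n else m mod n)"

definition psi :: "nat \<Rightarrow> (nat \<Rightarrow> int) \<Rightarrow> nat \<Rightarrow> nat" where
  "psi n w i = cyc_rep n (i + tau_V n w)"

definition vervaat :: "nat \<Rightarrow> (nat \<Rightarrow> int) \<Rightarrow> nat \<Rightarrow> int" where
  "vervaat n w = (\<lambda>j\<in>{0..n}. \<Sum>i=1..j. step w (psi n w i))"

definition vervaat_pairs :: "nat \<Rightarrow> ((nat \<Rightarrow> int) \<times> nat) set" where
  "vervaat_pairs n =
    {(v, k). v \<in> simple_walks n \<and> k \<le> n \<and>
       (\<forall>j. 0 \<le> j \<and> j \<le> k \<longrightarrow> 0 \<le> v j) \<and>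
       (\<forall>j. k \<le> j \<and> j < n \<longrightarrow> v n < v j)}"

end

theory Submission
  imports Defs
begin

text \<open>The Vervaat transform cuts the walk at time \<open>\<tau>\<close> and exchanges the two pieces, so cutting
  the result at time \<open>n - \<tau>\<close> undoes it. The two conditions defining a Vervaat pair \<open>(v, k)\<close> say
  precisely that, after cutting \<open>v\<close> at \<open>k\<close> and exchanging, the first minimum is at \<open>n - k\<close>.\<close>

text \<open>The cut \<open>t\<close> is a free parameter: \<open>t = tau_V n w\<close> gives the
  transform in closed form, and cutting at the \<open>k\<close> of a Vervaat pair gives its
  inverse.\<close>

definition rotate_walk :: "nat \<Rightarrow> nat \<Rightarrow> (nat \<Rightarrow> int) \<Rightarrow> nat \<Rightarrow> int" where
  "rotate_walk n t w =
    (\<lambda>j\<in>{0..n}. if j \<le> n - t then w (t + j) - w t else w n - w t + w (j - (n - t)))"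

lemma rotate_walk_le:
  "t \<le> n \<Longrightarrow> j \<le> n - t \<Longrightarrow> rotate_walk n t w j = w (t + j) - w t"
  by (auto simp: rotate_walk_def)

text \<open>At the junction \<open>j = n - t\<close> both branches give \<open>w n - w t\<close>,
  because \<open>w 0 = 0\<close>. The two evaluation rules thus overlap there.\<close>

lemma rotate_walk_ge:
  assumes "w 0 = 0" "t \<le> n" "n - t \<le> j" "j \<le> n"
  shows "rotate_walk n t w j = w n - w t + w (j - (n - t))"
  using assms by (cases "j = n - t") (auto simp: rotate_walk_def)

lemma step_rotate_walk:
  assumes "w 0 = 0" "t \<le> n" "1 \<le> j" "j \<le> n"
  shows "step (rotate_walk n t w) j = step w (cyc_rep n (j + t))"
proof (cases "j \<le> n - t")
  case True
  then have "cyc_rep n (j + t) = t + j"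
    using assms by (cases "j + t = n") (auto simp: cyc_rep_def)
  then show ?thesis
    using True assms by (simp add: step_def rotate_walk_le)
next
  case False
  have "cyc_rep n (j + t) = j - (n - t)"
  \<comment> \<open>Only here is \<open>j + t - n\<close> equal to \<open>n\<close>, so that the
    remainder is 0 and \<open>cyc_rep\<close> returns \<open>n\<close>. Otherwise it lies strictly
    between 0 and \<open>n\<close>.\<close>
  proof (cases "j = n \<and> t = n")
    case False
    then have "(j + t) mod n = j + t - n"
      using \<open>\<not> j \<le> n - t\<close> assms by (subst le_mod_geq) auto
    then show ?thesis
      using \<open>\<not> j \<le> n - t\<close> assms by (simp add: cyc_rep_def)
  qed (simp add: cyc_rep_def)
  \<comment> \<open>The predecessor \<open>j - 1\<close> may be the junction \<open>n - t\<close>,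
    which \<open>rotate_walk_ge\<close> still covers.\<close>
  moreover have "j - 1 - (n - t) = j - (n - t) - 1"
    by simp
  ultimately show ?thesis
    using False assms by (simp add: step_def rotate_walk_ge)
qed

lemma sum_step: "(\<Sum>i=1..j. step w i) = w j - w 0"
  by (induction j) (auto simp: step_def)

lemma tau_V_eqI:
  assumes "t \<le> n" "\<And>i. i \<le> n \<Longrightarrow> w t \<le> w i" "\<And>i. i < t \<Longrightarrow> w t < w i"
  shows "tau_V n w = t"
  unfolding tau_V_def
proof (rule Min_eqI)
  fix j assume "j \<in> {j \<in> {0..n}. \<forall>i\<in>{0..n}. w j \<le> w i}"
  then show "t \<le> j"
    using assms(1) assms(3)[of j] by (force simp: not_less[symmetric])
qed (use assms in auto)

lemma
  shows tau_V_le: "tau_V n w \<le> n"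
    and tau_V_minimal: "i \<le> n \<Longrightarrow> w (tau_V n w) \<le> w i"
    and tau_V_first: "i < tau_V n w \<Longrightarrow> w (tau_V n w) < w i"
proof -
  let ?M = "{j \<in> {0..n}. \<forall>i\<in>{0..n}. w j \<le> w i}"
  \<comment> \<open>An attained minimum makes the set \<open>?M\<close> nonempty, so that the
    \<open>Min\<close> in \<open>tau_V\<close> belongs to it.\<close>
  have "Min (w ` {0..n}) \<in> w ` {0..n}"
    by (rule Min_in) auto
  then obtain m where m: "m \<le> n" "w m = Min (w ` {0..n})"
    by (metis (no_types, lifting) atLeastAtMost_iff imageE)
  then have "m \<in> ?M"
    by auto
  then have "tau_V n w \<in> ?M"
    unfolding tau_V_def by (intro Min_in) auto
  then show le: "tau_V n w \<le> n" and min: "i \<le> n \<Longrightarrow> w (tau_V n w) \<le> w i" for i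
    by auto
  show "w (tau_V n w) < w i" if i: "i < tau_V n w"
  proof (rule ccontr)
    assume "\<not> w (tau_V n w) < w i"
    then have "i \<in> ?M"
      using i le min by fastforce
    then have "tau_V n w \<le> i"
      unfolding tau_V_def by (intro Min_le) auto
    then show False
      using i by simp
  qed
qed

text \<open>Both sides start at 0 and have the same increments, so telescoping identifies them on
  \<open>{0..n}\<close>; beyond \<open>n\<close> both are \<open>undefined\<close>.\<close>

lemma vervaat_eq_rotate_walk:
  assumes "w 0 = 0"
  shows "vervaat n w = rotate_walk n (tau_V n w) w"
proof
  fix j
  let ?r = "rotate_walk n (tau_V n w) w"
  show "vervaat n w j = ?r j"
  proof (cases "j \<le> n")
    case True
    have "(\<Sum>i=1..j. step w (psi n w i)) = (\<Sum>i=1..j. step ?r i)"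
      using True assms tau_V_le[of n w] by (intro sum.cong) (auto simp: psi_def step_rotate_walk)
    also have "\<dots> = ?r j"
      using tau_V_le[of n w] by (simp only: sum_step) (simp add: rotate_walk_le)
    finally show ?thesis
      using True by (simp add: vervaat_def)
  qed (simp add: vervaat_def rotate_walk_def)
qed

lemma cyc_rep_in: "1 \<le> n \<Longrightarrow> cyc_rep n m \<in> {1..n}"
  by (auto simp: cyc_rep_def Suc_le_eq intro: less_imp_le)

lemma rotate_walk_in_simple_walks:
  assumes "w \<in> simple_walks n" "t \<le> n"
  shows "rotate_walk n t w \<in> simple_walks n"
proof -
  have "rotate_walk n t w \<in> extensional {0..n}"
    by (simp add: rotate_walk_def)
  moreover have "rotate_walk n t w 0 = 0"
    using assms(2) by (simp add: rotate_walk_le)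
  moreover have "step (rotate_walk n t w) j \<in> {1, -1}" if "j \<in> {1..n}" for j
  proof -
    have "cyc_rep n (j + t) \<in> {1..n}"
      using that by (intro cyc_rep_in) auto
    then show ?thesis
      using assms that step_rotate_walk[of w t n j] by (simp add: simple_walks_def)
  qed
  ultimately show ?thesis
    by (simp add: simple_walks_def)
qed

lemma rotate_walk_rotate_walk:
  assumes "w \<in> extensional {0..n}" "w 0 = 0" "t \<le> n"
  shows "rotate_walk n (n - t) (rotate_walk n t w) = w"
proof
  fix j
  let ?r = "rotate_walk n t w"
  \<comment> \<open>The second cut is made at the junction of the first. These values make the
    offsets of the two rotations cancel on either piece.\<close>
  have r: "?r (n - t) = w n - w t" "?r n = w n" "?r 0 = 0"
    using assms by (simp_all add: rotate_walk_le rotate_walk_ge)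
  consider "j \<le> t" | "t < j" "j \<le> n" | "n < j"
    by linarith
  then show "rotate_walk n (n - t) ?r j = w j"
  proof cases
    case 1
    then show ?thesis
      using assms r rotate_walk_ge[of w t n "n - t + j"] by (simp add: rotate_walk_le)
  next
    case 2
    then show ?thesis
      using assms r rotate_walk_le[of t n "j - t" w] by (simp add: rotate_walk_ge)
  next
    case 3
    then show ?thesis
      using assms(1) by (simp add: rotate_walk_def extensional_def)
  qed
qed

text \<open>Minimality of \<open>w\<close> at the cut makes the piece moved to the front
  nonnegative. That the minimum is the first one puts the other piece strictly above its
  endpoint.\<close>

lemma rotate_walk_tau_V_in_vervaat_pairs:
  assumes "w \<in> simple_walks n"
  shows "(rotate_walk n (tau_V n w) w, n - tau_V n w) \<in> vervaat_pairs n"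
proof -
  define t where "t = tau_V n w"
  have t: "t \<le> n" and w0: "w 0 = 0"
    using assms by (simp_all add: t_def tau_V_le simple_walks_def)
  have "0 \<le> rotate_walk n t w j" if "j \<le> n - t" for j
    using that t tau_V_minimal[of "t + j" n w] by (simp add: rotate_walk_le t_def)
  moreover have "rotate_walk n t w n < rotate_walk n t w j" if "n - t \<le> j" "j < n" for j
    using that t w0 tau_V_first[of "j - (n - t)" n w] by (simp add: rotate_walk_ge t_def)
  ultimately show ?thesis
    using rotate_walk_in_simple_walks[OF assms t] by (simp add: vervaat_pairs_def flip: t_def)
qed

text \<open>The value at \<open>n - k\<close> is \<open>v n - v k\<close>. Earlier values are
  \<open>v (k + i) - v k\<close>, larger by the strict condition; later ones add some
  \<open>v j\<close> with \<open>j \<le> k\<close>, which is nonnegative.\<close>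

lemma tau_V_rotate_walk:
  assumes "(v, k) \<in> vervaat_pairs n"
  shows "tau_V n (rotate_walk n k v) = n - k"
proof (rule tau_V_eqI)
  have k: "k \<le> n" and v0: "v 0 = 0"
    and nonneg: "\<And>j. j \<le> k \<Longrightarrow> 0 \<le> v j"
    and gt: "\<And>j. k \<le> j \<Longrightarrow> j < n \<Longrightarrow> v n < v j"
    using assms by (auto simp: vervaat_pairs_def simple_walks_def)
  have r: "rotate_walk n k v (n - k) = v n - v k"
    using k by (simp add: rotate_walk_le)
  show first: "rotate_walk n k v (n - k) < rotate_walk n k v i" if "i < n - k" for i
    using that k r gt[of "k + i"] by (simp add: rotate_walk_le)
  show "rotate_walk n k v (n - k) \<le> rotate_walk n k v i" if "i \<le> n" for i
  proof (cases "i < n - k")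
    case False
    then show ?thesis
      using that k v0 r nonneg[of "i - (n - k)"] by (simp add: rotate_walk_ge)
  qed (use first in force)
qed simp

theorem theorem7p3:
  fixes n :: nat
  assumes "n \<ge> 1"
  shows "bij_betw (\<lambda>w. (vervaat n w, n - tau_V n w)) (simple_walks n) (vervaat_pairs n)"
proof (rule bij_betw_byWitness[where f' = "\<lambda>(v, k). rotate_walk n k v"])
  have simple: "w \<in> extensional {0..n}" "w 0 = 0" if "w \<in> simple_walks n" for w
    using that by (auto simp: simple_walks_def)
  have pair: "v \<in> simple_walks n" "k \<le> n" if "(v, k) \<in> vervaat_pairs n" for v k
    using that by (auto simp: vervaat_pairs_def)
  show "\<forall>w\<in>simple_walks n. (case (vervaat n w, n - tau_V n w) of (v, k) \<Rightarrow> rotate_walk n k v) = w"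
    by (simp add: vervaat_eq_rotate_walk rotate_walk_rotate_walk simple tau_V_le)
  show "(\<lambda>w. (vervaat n w, n - tau_V n w)) ` simple_walks n \<subseteq> vervaat_pairs n"
    by (auto simp: vervaat_eq_rotate_walk simple rotate_walk_tau_V_in_vervaat_pairs)
  show "(\<lambda>(v, k). rotate_walk n k v) ` vervaat_pairs n \<subseteq> simple_walks n"
    using pair by (auto intro: rotate_walk_in_simple_walks)
  show "\<forall>p\<in>vervaat_pairs n. (vervaat n (case p of (v, k) \<Rightarrow> rotate_walk n k v),
      n - tau_V n (case p of (v, k) \<Rightarrow> rotate_walk n k v)) = p"
  proof clarify
    fix v k assume p: "(v, k) \<in> vervaat_pairs n"
    note pair = pair[OF p]
    \<comment> \<open>The rotated walk has its first minimum at \<open>n - k\<close>, so the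
      transform cuts exactly where the rotation at \<open>k\<close> is undone.\<close>
    have "vervaat n (rotate_walk n k v) = rotate_walk n (n - k) (rotate_walk n k v)"
      using rotate_walk_in_simple_walks[OF pair]
      by (simp add: vervaat_eq_rotate_walk simple tau_V_rotate_walk[OF p])
    then show "vervaat n (rotate_walk n k v) = v \<and> n - tau_V n (rotate_walk n k v) = k"
      using pair by (simp add: rotate_walk_rotate_walk simple tau_V_rotate_walk[OF p])
  qed
qed

end
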